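(* Let $\mathcal{A}$ be a standard $\mathsf{S4}^C_I$-algebra. Then there exists a family of topologies $(\tau_i)_{i\in I}$ on $\mathit{Ult}\,\mathcal{A}$ such that $\widehat{\Box_i a}=\mathrm{Int}_{\tau_i}(\widehat{a})$ for every element $a$ of $\mathcal{A}$ and every $i\in I$, and moreover $\widehat{\mathsf{C}a}=\mathrm{Int}_\tau(\widehat{a})$ for every element $a$ of $\mathcal{A}$, where $\tau=\bigcap_{i\in I}\tau_i$.
   Context: Fix a finite non-empty set $I$. An interior algebra is a Boolean algebra with a unary operation $\Box$ such that $\Box1=1$, $\Box(x\wedge y)=\Box x\wedge\Box y$, $\Box x=\Box\Box x$, $\Box x\le x$. An $\mathsf{S4}^C_I$-algebra is a Boolean algebra $A$ with unary operations $\Box_i$ ($i\in I$) and $\mathsf{C}$ such that each $\Box_i$ and $\mathsf{C}$ make $A$ an interior algebra, and $\mathsf{C}a\le\mathsf{E}a\wedge\mathsf{E}\mathsf{C}a$ and $\mathsf{E}a\wedge\mathsf{C}(a\to\mathsf{E}a)\le\mathsf{C}a$ for all $a\in A$, where $\mathsf{E}a:=\bigwedge_{i\in I}\Box_i a$. It is standard if, for every element $d$ and every sequence $(a_j)_{j\in\mathbb{N}}$ of elements with $a_j\le\mathsf{E}d\wedge\mathsf{E}a_{j+1}$ for all $j\in\mathbb{N}$, we have $a_0\le\mathsf{C}d$. $\mathit{Ult}\,\mathcal{A}$ is the set of all ultrafilters of the Boolean part of $\mathcal{A}$, and $\widehat{a}=\{u\in\mathit{Ult}\,\mathcal{A}\mid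 a\in u\}$. $\mathrm{Int}_\sigma$ denotes the interior operator of a topology $\sigma$. *)

theory Defs
  imports "HOL-Analysis.Abstract_Topology"
begin

locale interior_algebra =
  fixes int_op :: "'a::boolean_algebra \<Rightarrow> 'a"
  assumes int_top: "int_op top = top"
    and int_inf: "int_op (inf x y) = inf (int_op x) (int_op y)"
    and int_idem: "int_op x = int_op (int_op x)"
    and int_le: "int_op x \<le> x"

(* Inf_fin is the meet of a finite non-empty set; it is used below only for such index sets I. *)
definition everybody :: "'i set \<Rightarrow> ('i \<Rightarrow> 'a::boolean_algebra \<Rightarrow> 'a) \<Rightarrow> 'a \<Rightarrow> 'a" where
  "everybody I Box a = Inf_fin ((\<lambda>i. Box i a) ` I)"

locale S4C_algebra =
  fixes I :: "'i set"
    and Box :: "'i \<Rightarrow> 'a::boolean_algebra \<Rightarrow> 'a"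
    and C :: "'a \<Rightarrow> 'a"
  assumes finite_agents: "finite I"
    and nonempty_agents: "I \<noteq> {}"
    and Box_interior: "i \<in> I \<Longrightarrow> interior_algebra (Box i)"
    and C_interior: "interior_algebra C"
    and C_le: "C a \<le> inf (everybody I Box a) (everybody I Box (C a))"
    (* Boolean implication x \<longrightarrow> y is rendered as sup (- x) y. *)
    and C_induction: "inf (everybody I Box a) (C (sup (- a) (everybody I Box a))) \<le> C a"

locale standard_S4C_algebra = S4C_algebra I Box C
  for I :: "'i set" and Box :: "'i \<Rightarrow> 'a::boolean_algebra \<Rightarrow> 'a" and C :: "'a \<Rightarrow> 'a" +
  assumes standard:
    "(\<And>j. s j \<le> inf (everybody I Box d) (everybody I Box (s (Suc j)))) \<Longrightarrow> s (0::nat) \<le> C d"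

definition ba_filter :: "'a::boolean_algebra set \<Rightarrow> bool" where
  "ba_filter F \<longleftrightarrow> F \<noteq> {} \<and> (\<forall>x\<in>F. \<forall>y\<in>F. inf x y \<in> F) \<and> (\<forall>x\<in>F. \<forall>y. x \<le> y \<longrightarrow> y \<in> F)"

definition ba_ultrafilter :: "'a::boolean_algebra set \<Rightarrow> bool" where
  "ba_ultrafilter u \<longleftrightarrow> ba_filter u \<and> u \<noteq> UNIV \<and>
     (\<forall>F. ba_filter F \<and> F \<noteq> UNIV \<and> u \<subseteq> F \<longrightarrow> F = u)"

definition Ult :: "'a::boolean_algebra set set" where
  "Ult = {u. ba_ultrafilter u}"

definition hat :: "'a::boolean_algebra \<Rightarrow> 'a set set" where
  "hat a = {u \<in> Ult. a \<in> u}"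

definition inter_topology :: "'i set \<Rightarrow> ('i \<Rightarrow> 'x topology) \<Rightarrow> 'x topology" where
  "inter_topology I T = topology (\<lambda>U. \<forall>i\<in>I. openin (T i) U)"

lemma openin_inter_topology:
  "openin (inter_topology I T) U \<longleftrightarrow> (\<forall>i\<in>I. openin (T i) U)"
proof -
  have "istopology (\<lambda>U. \<forall>i\<in>I. openin (T i) U)"
    unfolding istopology_def by blast
  then show ?thesis
    by (simp add: inter_topology_def topology_inverse')
qed

end

theory Submission
  imports Defs
begin

text \<open>
  Give the ultrafilter space, for each agent \<open>i\<close>, the coarsest topology that makes the sets
  \<open>hat (Box i a)\<close> open. These sets form a base, and \<open>hat (Box i a)\<close> is the largest basic set
  inside \<open>hat a\<close>, so the interior of \<open>hat a\<close> is \<open>hat (Box i a)\<close> (\<open>interior_box_topology_hat\<close>).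

  For \<open>C\<close>, the inequality \<open>C d \<le> Box i (C d)\<close> makes \<open>hat (C d)\<close> open in every one of these
  topologies, so it lies in the interior of \<open>hat d\<close> for their intersection. The converse is where
  standardness enters. Let \<open>U\<close> be a subset of \<open>hat d\<close> that is open in every topology, and let
  \<open>u \<in> U\<close>. Some clopen set \<open>hat (s 0)\<close> contains \<open>u\<close> and lies in \<open>U\<close>. By
  compactness of the Stone space, a clopen subset \<open>hat a\<close> of \<open>U\<close> is covered, for each agent,
  by finitely many basic sets inside \<open>U\<close>; their join is again a fixed point of that agent's box.
  Since there are finitely many agents, a further join gives a single \<open>b\<close> with
  \<open>a \<le> everybody I Box b\<close> and still \<open>hat b \<subseteq> U\<close> (\<open>everybody_step\<close>). Iterating from \<open>s 0\<close> yields
  an infinite sequence below \<open>d\<close> to which the standardness rule applies, and its conclusion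
  \<open>s 0 \<le> C d\<close> gives \<open>u \<in> hat (C d)\<close>.
\<close>

section \<open>Ultrafilters of a Boolean algebra\<close>

lemma ba_filter_inf: "ba_filter F \<Longrightarrow> x \<in> F \<Longrightarrow> y \<in> F \<Longrightarrow> inf x y \<in> F"
  unfolding ba_filter_def by blast

lemma ba_filter_mono: "ba_filter F \<Longrightarrow> x \<in> F \<Longrightarrow> x \<le> y \<Longrightarrow> y \<in> F"
  unfolding ba_filter_def by blast

lemma ba_filter_top: "ba_filter F \<Longrightarrow> top \<in> F"
  unfolding ba_filter_def by (metis all_not_in_conv top_greatest)

lemma ba_filter_eq_UNIV_iff: "ba_filter F \<Longrightarrow> F = UNIV \<longleftrightarrow> bot \<in> F"
  using ba_filter_mono[of F bot] by auto

lemma Ult_iff: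
  "u \<in> Ult \<longleftrightarrow> ba_filter u \<and> bot \<notin> u \<and> (\<forall>F. ba_filter F \<and> bot \<notin> F \<and> u \<subseteq> F \<longrightarrow> F = u)"
  unfolding Ult_def ba_ultrafilter_def using ba_filter_eq_UNIV_iff by auto

lemma Ult_filter: "u \<in> Ult \<Longrightarrow> ba_filter u"
  by (simp add: Ult_iff)

lemma filter_extends_to_ultrafilter:
  assumes F: "ba_filter F" "bot \<notin> F"
  shows "\<exists>u\<in>Ult. F \<subseteq> u"
proof -
  let ?\<A> = "{G. ba_filter G \<and> bot \<notin> G \<and> F \<subseteq> G}"
  have "\<exists>M\<in>?\<A>. \<forall>X\<in>?\<A>. M \<subseteq> X \<longrightarrow> X = M"
  proof (rule subset_Zorn_nonempty)
    show "?\<A> \<noteq> {}" using F by auto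
  next
    fix \<C> assume ne: "\<C> \<noteq> {}" and chain: "subset.chain ?\<A> \<C>"
    then have mem: "\<And>G. G \<in> \<C> \<Longrightarrow> ba_filter G \<and> bot \<notin> G \<and> F \<subseteq> G"
      by (auto simp: subset.chain_def)
    have "inf x y \<in> \<Union>\<C>" if xy: "x \<in> \<Union>\<C>" "y \<in> \<Union>\<C>" for x y
    proof -
      obtain G where "G \<in> \<C>" "x \<in> G" "y \<in> G"
        using xy chain unfolding subset_chain_def by blast
      then show ?thesis using mem ba_filter_inf by blast
    qed
    moreover have "y \<in> \<Union>\<C>" if "x \<in> \<Union>\<C>" "x \<le> y" for x y
      using that mem ba_filter_mono by blast
    moreover have "\<Union>\<C> \<noteq> {}"
      using ne mem ba_filter_top by blast
    ultimately have "ba_filter (\<Union>\<C>)"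
      unfolding ba_filter_def by blast
    moreover have "F \<subseteq> \<Union>\<C>" "bot \<notin> \<Union>\<C>"
      using ne mem by blast+
    ultimately show "\<Union>\<C> \<in> ?\<A>" by blast
  qed
  then obtain M where "ba_filter M" "bot \<notin> M" "F \<subseteq> M"
    and max: "\<And>X. ba_filter X \<Longrightarrow> bot \<notin> X \<Longrightarrow> F \<subseteq> X \<Longrightarrow> M \<subseteq> X \<Longrightarrow> X = M"
    by auto
  then have "M \<in> Ult"
    unfolding Ult_iff by blast
  then show ?thesis using \<open>F \<subseteq> M\<close> by blast
qed

lemma Ult_prime:
  assumes u: "u \<in> Ult" and xy: "sup x y \<in> u"
  shows "x \<in> u \<or> y \<in> u"
proof (rule disjCI)
  assume "y \<notin> u"
  \<comment> \<open>Otherwise the following proper filter, which contains \<open>u\<close>, would have to equal \<open>u\<close>.\<close>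
  let ?F = "{z. sup z y \<in> u}"
  have "ba_filter ?F"
    unfolding ba_filter_def
  proof (intro conjI ballI allI impI)
    show "?F \<noteq> {}" using xy by blast
  next
    fix v w assume "v \<in> ?F" "w \<in> ?F"
    then show "inf v w \<in> ?F"
      using ba_filter_inf[OF Ult_filter[OF u]] by (simp add: sup_inf_distrib2)
  next
    fix v w :: 'a assume "v \<in> ?F" "v \<le> w"
    then show "w \<in> ?F"
      using ba_filter_mono[OF Ult_filter[OF u]] by (auto intro: sup_mono)
  qed
  moreover have "bot \<notin> ?F" using \<open>y \<notin> u\<close> by simp
  moreover have "u \<subseteq> ?F"
    using ba_filter_mono[OF Ult_filter[OF u]] by auto
  ultimately have "?F = u" using u by (simp add: Ult_iff)
  then show "x \<in> u" using xy by blast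
qed

lemma hat_subset_Ult: "hat a \<subseteq> Ult"
  by (auto simp: hat_def)

lemma hat_top: "hat top = Ult"
  by (auto simp: hat_def Ult_iff ba_filter_top)

lemma hat_bot: "hat bot = {}"
  by (auto simp: hat_def Ult_iff)

lemma hat_mono: "a \<le> b \<Longrightarrow> hat a \<subseteq> hat b"
  unfolding hat_def using ba_filter_mono Ult_filter by blast

lemma hat_inf: "hat (inf a b) = hat a \<inter> hat b"
proof
  show "hat (inf a b) \<subseteq> hat a \<inter> hat b" by (simp add: hat_mono)
  show "hat a \<inter> hat b \<subseteq> hat (inf a b)"
    unfolding hat_def using ba_filter_inf Ult_filter by blast
qed

lemma hat_sup: "hat (sup a b) = hat a \<union> hat b"
proof
  show "hat a \<union> hat b \<subseteq> hat (sup a b)" by (simp add: hat_mono)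
  show "hat (sup a b) \<subseteq> hat a \<union> hat b"
    unfolding hat_def using Ult_prime by blast
qed

text \<open>
  Compactness of the Stone space, for covers by a family closed under finite joins; such a family
  needs only one of its members. If no member of \<open>S\<close> lies above \<open>a\<close>, then \<open>a\<close> together with
  the complements of the members of \<open>S\<close> generates a proper filter, and any ultrafilter extending it
  is a point of \<open>hat a\<close> that the family misses.
\<close>

lemma hat_compact:
  assumes bot: "bot \<in> S" and sup: "\<And>s t. s \<in> S \<Longrightarrow> t \<in> S \<Longrightarrow> sup s t \<in> S"
    and cover: "hat a \<subseteq> (\<Union>s\<in>S. hat s)"
  shows "\<exists>s\<in>S. a \<le> s"
proof (rule ccontr)
  assume no: "\<not> (\<exists>s\<in>S. a \<le> s)"
  \<comment> \<open>The condition \<open>a \<le> sup s x\<close> is \<open>inf a (- s) \<le> x\<close>.\<close>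
  let ?F = "{x. \<exists>s\<in>S. a \<le> sup s x}"
  have "ba_filter ?F"
    unfolding ba_filter_def
  proof (intro conjI ballI allI impI)
    show "?F \<noteq> {}" using bot by (auto intro!: exI[of _ a])
  next
    fix x y assume "x \<in> ?F" "y \<in> ?F"
    then obtain s t where st: "s \<in> S" "t \<in> S" "a \<le> sup s x" "a \<le> sup t y" by blast
    have "a \<le> sup (sup s t) x" "a \<le> sup (sup s t) y"
      by (rule order_trans[OF st(3) sup_mono] order_trans[OF st(4) sup_mono]; simp)+
    then have "a \<le> sup (sup s t) (inf x y)" by (simp add: sup_inf_distrib1)
    then show "inf x y \<in> ?F" using sup st(1,2) by blast
  next
    fix x y :: 'a assume "x \<in> ?F" "x \<le> y"
    then show "y \<in> ?F" using order_trans[OF _ sup_mono[OF order_refl]] by blast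
  qed
  moreover have "bot \<notin> ?F" using no by simp
  ultimately obtain u where u: "u \<in> Ult" "?F \<subseteq> u"
    using filter_extends_to_ultrafilter by blast
  have "a \<le> sup bot a" by simp
  then have "a \<in> u" using u(2) bot by blast
  then obtain s where s: "s \<in> S" "s \<in> u"
    using cover u(1) by (auto simp: hat_def)
  have "a \<le> sup s (- s)" by simp
  then have "- s \<in> u" using u(2) s(1) by blast
  then have "inf s (- s) \<in> u"
    using ba_filter_inf[OF Ult_filter[OF u(1)]] s(2) by blast
  then show False using u(1) by (simp add: Ult_iff)
qed

lemma hat_subset_iff: "hat a \<subseteq> hat b \<longleftrightarrow> a \<le> b"
proof
  assume "hat a \<subseteq> hat b"
  then have "\<exists>s\<in>{s. s \<le> b}. a \<le> s"
    by (intro hat_compact) auto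
  then show "a \<le> b" by auto
qed (rule hat_mono)

section \<open>The topology of an interior operator\<close>

context interior_algebra
begin

lemma int_mono: "x \<le> y \<Longrightarrow> int_op x \<le> int_op y"
  using int_inf[of x y] by (simp add: inf.absorb_iff1)

lemma int_fixed_sup:
  assumes "int_op x = x" "int_op y = y"
  shows "int_op (sup x y) = sup x y"
proof (rule antisym[OF int_le])
  show "sup x y \<le> int_op (sup x y)"
    using int_mono[of x "sup x y"] int_mono[of y "sup x y"] assms by simp
qed

end

text \<open>
  This is the topology with base \<open>hat (f a)\<close>, with openness stated pointwise. It is a topology
  when \<open>f\<close> is an interior operator, because the values of \<open>f\<close> are then closed under \<open>inf\<close>.
\<close>

definition box_topology :: "('a::boolean_algebra \<Rightarrow> 'a) \<Rightarrow> 'a set topology" where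
  "box_topology f = topology (\<lambda>U. U \<subseteq> Ult \<and> (\<forall>u\<in>U. \<exists>a. u \<in> hat (f a) \<and> hat (f a) \<subseteq> U))"

lemma openin_box_topology:
  assumes "interior_algebra f"
  shows "openin (box_topology f) U \<longleftrightarrow>
    U \<subseteq> Ult \<and> (\<forall>u\<in>U. \<exists>a. u \<in> hat (f a) \<and> hat (f a) \<subseteq> U)"
proof -
  interpret interior_algebra f by fact
  let ?P = "\<lambda>U. U \<subseteq> Ult \<and> (\<forall>u\<in>U. \<exists>a. u \<in> hat (f a) \<and> hat (f a) \<subseteq> U)"
  have "?P (S \<inter> T)" if S: "?P S" and T: "?P T" for S T
  proof (intro conjI ballI)
    show "S \<inter> T \<subseteq> Ult" using S by blast
  next
    fix u assume u: "u \<in> S \<inter> T"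
    obtain a where "u \<in> hat (f a)" "hat (f a) \<subseteq> S" using S u by blast
    moreover obtain b where "u \<in> hat (f b)" "hat (f b) \<subseteq> T" using T u by blast
    ultimately have "u \<in> hat (f (inf a b)) \<and> hat (f (inf a b)) \<subseteq> S \<inter> T"
      by (auto simp: int_inf hat_inf)
    then show "\<exists>c. u \<in> hat (f c) \<and> hat (f c) \<subseteq> S \<inter> T" by blast
  qed
  moreover have "?P (\<Union>\<K>)" if \<K>: "\<forall>K\<in>\<K>. ?P K" for \<K>
  proof (intro conjI ballI)
    show "\<Union>\<K> \<subseteq> Ult" using \<K> by blast
  next
    fix u assume "u \<in> \<Union>\<K>"
    then obtain K where K: "K \<in> \<K>" "u \<in> K" by blast
    then obtain a where "u \<in> hat (f a)" "hat (f a) \<subseteq> K" using \<K> by blast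
    then show "\<exists>a. u \<in> hat (f a) \<and> hat (f a) \<subseteq> \<Union>\<K>" using K(1) by blast
  qed
  ultimately have "istopology ?P"
    unfolding istopology_def by blast
  then show ?thesis by (simp add: box_topology_def topology_inverse')
qed

lemma openin_box_topology_hat:
  assumes "interior_algebra f"
  shows "openin (box_topology f) (hat (f a))"
  using hat_subset_Ult by (auto simp: openin_box_topology[OF assms])

lemma topspace_box_topology:
  assumes "interior_algebra f"
  shows "topspace (box_topology f) = Ult"
proof
  show "topspace (box_topology f) \<subseteq> Ult"
    using openin_topspace[of "box_topology f"] openin_box_topology[OF assms] by blast
  show "Ult \<subseteq> topspace (box_topology f)"
    using openin_subset[OF openin_box_topology_hat[OF assms, of top]]
    by (simp add: interior_algebra.int_top[OF assms] hat_top)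
qed

text \<open>
  A basic set \<open>hat (f b)\<close> inside \<open>hat a\<close> has \<open>f b \<le> a\<close>; applying \<open>f\<close>, which fixes \<open>f b\<close>, gives
  \<open>f b \<le> f a\<close>.
\<close>

lemma interior_box_topology_hat:
  assumes "interior_algebra f"
  shows "box_topology f interior_of hat a = hat (f a)"
proof (rule interior_of_unique)
  interpret interior_algebra f by fact
  show "hat (f a) \<subseteq> hat a" by (rule hat_mono[OF int_le])
  show "openin (box_topology f) (hat (f a))" by (rule openin_box_topology_hat[OF assms])
  show "U \<subseteq> hat (f a)" if U: "U \<subseteq> hat a" "openin (box_topology f) U" for U
  proof
    fix u assume "u \<in> U"
    then obtain b where b: "u \<in> hat (f b)" "hat (f b) \<subseteq> U"
      using U(2) openin_box_topology[OF assms] by blast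
    then have "f b \<le> a" using U(1) hat_subset_iff by blast
    then have "f b \<le> f a" using int_mono int_idem by metis
    then show "u \<in> hat (f a)" using b(1) hat_mono by blast
  qed
qed

text \<open>
  Compactness puts one fixed point between a clopen set and an open set around it: the
  fixed points inside \<open>U\<close> cover \<open>U\<close> and are closed under finite joins.
\<close>

lemma fixed_point_between:
  assumes "interior_algebra f" and U: "openin (box_topology f) U" and a: "hat a \<subseteq> U"
  shows "\<exists>s. f s = s \<and> a \<le> s \<and> hat s \<subseteq> U"
proof -
  interpret interior_algebra f by fact
  let ?S = "{s. f s = s \<and> hat s \<subseteq> U}"
  have "\<exists>s\<in>?S. a \<le> s"
  proof (rule hat_compact)
    have "f bot = bot" using int_le[of bot] by (simp add: bot_unique)
    then show "bot \<in> ?S" by (simp add: hat_bot)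
    show "sup s t \<in> ?S" if "s \<in> ?S" "t \<in> ?S" for s t
      using that by (simp add: int_fixed_sup hat_sup)
    show "hat a \<subseteq> (\<Union>s\<in>?S. hat s)"
    proof
      fix u assume "u \<in> hat a"
      then obtain b where "u \<in> hat (f b)" "hat (f b) \<subseteq> U"
        using a U openin_box_topology[OF assms(1)] by blast
      moreover have "f (f b) = f b" using int_idem by simp
      ultimately show "u \<in> (\<Union>s\<in>?S. hat s)" by blast
    qed
  qed
  then show ?thesis by blast
qed

section \<open>Common knowledge and the intersection topology\<close>

context S4C_algebra
begin

lemma le_everybody_iff: "a \<le> everybody I Box b \<longleftrightarrow> (\<forall>i\<in>I. a \<le> Box i b)"
  unfolding everybody_def using finite_agents nonempty_agents
  by (simp add: Inf_fin.bounded_iff)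

lemma everybody_mono: "a \<le> b \<Longrightarrow> everybody I Box a \<le> everybody I Box b"
proof -
  assume ab: "a \<le> b"
  have "everybody I Box a \<le> Box i b" if i: "i \<in> I" for i
  proof (rule order_trans)
    show "everybody I Box a \<le> Box i a" using i le_everybody_iff by blast
    show "Box i a \<le> Box i b" by (rule interior_algebra.int_mono[OF Box_interior[OF i] ab])
  qed
  then show "everybody I Box a \<le> everybody I Box b" by (simp add: le_everybody_iff)
qed

lemma openin_all_hat_C:
  "openin (inter_topology I (\<lambda>i. box_topology (Box i))) (hat (C a))"
proof -
  have fixed: "Box i (C a) = C a" if i: "i \<in> I" for i
  proof (rule antisym)
    show "Box i (C a) \<le> C a" by (rule interior_algebra.int_le[OF Box_interior[OF i]])
    have "C a \<le> everybody I Box (C a)" using C_le[of a] by simp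
    then show "C a \<le> Box i (C a)" using i le_everybody_iff by blast
  qed
  have "openin (box_topology (Box i)) (hat (C a))" if i: "i \<in> I" for i
    using openin_box_topology_hat[OF Box_interior[OF i], of "C a"] fixed[OF i] by simp
  then show ?thesis by (simp add: openin_inter_topology)
qed

text \<open>
  One link of the chain required by standardness. Each agent supplies an intermediate fixed point;
  finiteness of \<open>I\<close> lets all of them be absorbed into one join whose clopen set stays inside \<open>U\<close>.
\<close>

lemma everybody_step:
  assumes U: "openin (inter_topology I (\<lambda>i. box_topology (Box i))) U" and a: "hat a \<subseteq> U"
  shows "\<exists>b. a \<le> everybody I Box b \<and> hat b \<subseteq> U"
proof -
  have "\<exists>b. (\<forall>i\<in>J. a \<le> Box i b) \<and> hat b \<subseteq> U" if "finite J" "J \<subseteq> I" for J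
    using that
  proof (induction J rule: finite_induct)
    case empty
    then show ?case using a by blast
  next
    case (insert i J)
    then obtain b where b: "\<forall>j\<in>J. a \<le> Box j b" "hat b \<subseteq> U" by blast
    have i: "i \<in> I" using insert by simp
    obtain s where s: "Box i s = s" "a \<le> s" "hat s \<subseteq> U"
      using fixed_point_between[OF Box_interior[OF i] _ a] U i
      by (auto simp: openin_inter_topology)
    have "a \<le> Box j (sup b s)" if j: "j \<in> J" for j
    proof (rule order_trans)
      show "a \<le> Box j b" using b(1) j by blast
      have "j \<in> I" using insert.prems j by blast
      then show "Box j b \<le> Box j (sup b s)"
        by (simp add: interior_algebra.int_mono[OF Box_interior])
    qed
    moreover have "a \<le> Box i (sup b s)"
      using interior_algebra.int_mono[OF Box_interior[OF i], of s "sup b s"] s(1,2) by simp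
    ultimately show ?case using b(2) s(3) by (intro exI[of _ "sup b s"]) (simp add: hat_sup)
  qed
  from this[OF finite_agents order_refl] show ?thesis by (simp add: le_everybody_iff)
qed

end

context standard_S4C_algebra
begin

lemma interior_inter_topology_hat:
  "inter_topology I (\<lambda>i. box_topology (Box i)) interior_of hat d = hat (C d)"
proof (rule interior_of_unique)
  show "hat (C d) \<subseteq> hat d" by (rule hat_mono[OF interior_algebra.int_le[OF C_interior]])
  show "openin (inter_topology I (\<lambda>i. box_topology (Box i))) (hat (C d))"
    by (rule openin_all_hat_C)
  show "U \<subseteq> hat (C d)"
    if U: "U \<subseteq> hat d" "openin (inter_topology I (\<lambda>i. box_topology (Box i))) U" for U
  proof
    fix u assume u: "u \<in> U"
    obtain i where i: "i \<in> I" using nonempty_agents by blast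
    obtain c where c: "u \<in> hat (Box i c)" "hat (Box i c) \<subseteq> U"
      using U(2) u i openin_box_topology[OF Box_interior[OF i]]
      unfolding openin_inter_topology by blast
    obtain s where s: "s 0 = Box i c" "\<And>j. hat (s j) \<subseteq> U" "\<And>j. s j \<le> everybody I Box (s (Suc j))"
    proof -
      obtain next_b where nb: "\<And>a. hat a \<subseteq> U \<Longrightarrow> a \<le> everybody I Box (next_b a) \<and> hat (next_b a) \<subseteq> U"
        using everybody_step[OF U(2)] by metis
      let ?s = "\<lambda>j. (next_b ^^ j) (Box i c)"
      have "hat (?s j) \<subseteq> U" for j
        by (induction j) (use c(2) nb in auto)
      then show ?thesis using that[of ?s] nb by auto
    qed
    have "s j \<le> everybody I Box d" for j
    proof (rule order_trans[OF s(3) everybody_mono])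
      show "s (Suc j) \<le> d" using s(2) U(1) hat_subset_iff by blast
    qed
    then have "s 0 \<le> C d"
      using s(3) by (intro standard) simp
    then show "u \<in> hat (C d)" using c(1) s(1) hat_mono by auto
  qed
qed

end

theorem theorem2:
  fixes I :: "'i set"
    and Box :: "'i \<Rightarrow> 'a::boolean_algebra \<Rightarrow> 'a"
    and C :: "'a \<Rightarrow> 'a"
  assumes "standard_S4C_algebra I Box C"
  shows "\<exists>T :: 'i \<Rightarrow> 'a set topology.
    (\<forall>i\<in>I. topspace (T i) = Ult) \<and>
    (\<forall>i\<in>I. \<forall>a. hat (Box i a) = T i interior_of hat a) \<and>
    (\<forall>a. hat (C a) = inter_topology I T interior_of hat a)"
proof -
  interpret standard_S4C_algebra I Box C by fact
  show ?thesis
  proof (intro exI[of _ "\<lambda>i. box_topology (Box i)"] conjI ballI allI)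
    fix i a assume i: "i \<in> I"
    show "topspace (box_topology (Box i)) = Ult"
      by (rule topspace_box_topology[OF Box_interior[OF i]])
    show "hat (Box i a) = box_topology (Box i) interior_of hat a"
      by (rule interior_box_topology_hat[OF Box_interior[OF i], symmetric])
  qed (rule interior_inter_topology_hat[symmetric])
qed

end
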